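(* Let $q$ be a power of an odd prime and let $m\ge 3$ be an integer with $m\mid q+1$. Let $0\le i_1<i_2\le m-1$ be such that the subgraph of $\mathrm{GP}(q^2,m)$ induced by $Q_{i_1}\cup Q_{i_2}$ is a complete bipartite graph with parts $Q_{i_1}$ and $Q_{i_2}$. Define $f=f_{Q_{i_1},Q_{i_2}}:\mathbb{F}_{q^2}\to\mathbb{R}$ by $f(\gamma)=1$ if $\gamma\in Q_{i_1}$, $f(\gamma)=-1$ if $\gamma\in Q_{i_2}$, and $f(\gamma)=0$ otherwise. Then $f$ is an eigenfunction of $\mathrm{GP}(q^2,m)$ corresponding to the eigenvalue $-\frac{q+1}{m}$, and its support has cardinality $\frac{2(q+1)}{m}$; in particular it attains the weight-distribution lower bound, which states that every $(-\frac{q+1}{m})$-eigenfunction of $\mathrm{GP}(q^2,m)$ has at least $\frac{2(q+1)}{m}$ non-zeroes.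
   Context: The generalised Paley graph $\mathrm{GP}(q^2,m)$ has vertex set $\mathbb{F}_{q^2}$, with two distinct vertices $x,y$ adjacent iff $x-y$ is an $m$-th power of an element of $\mathbb{F}_{q^2}^*$. Fix a primitive element $\beta$ of $\mathbb{F}_{q^2}$, let $\omega=\beta^{q-1}$, $Q=\langle\omega\rangle$ (a subgroup of order $q+1$ of $\mathbb{F}_{q^2}^*$), $Q_0=\langle\omega^m\rangle$, and $Q_i=\omega^iQ_0$ for $0\le i\le m-1$. For an eigenvalue $\theta$ of a graph $X$, a $\theta$-eigenfunction is a real-valued function $f\not\equiv 0$ on the vertex set such that $\theta f(\gamma)=\sum_{\delta\in X(\gamma)}f(\delta)$ for every vertex $\gamma$, where $X(\gamma)$ is the set of neighbours of $\gamma$. *)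

theory Defs
  imports Complex_Main "HOL-Library.Cardinality" "HOL-Computational_Algebra.Primes"
    "Graph_Theory.Digraph_Component" "Graph_Theory.Pair_Digraph"
begin

text \<open>
  Undirected graphs are symmetric loop-free digraphs (locale \<^locale>\<open>graph\<close>), with ordered
  pairs as arcs. The field \<open>\<bbbF>\<^bsub>q\<^sup>2\<^esub>\<close> is a type of class \<open>{field,finite}\<close> with \<open>q\<^sup>2\<close> elements.
\<close>

definition gen_paley :: "nat \<Rightarrow> ('a::{field,finite}, 'a \<times> 'a) pre_digraph" where
  "gen_paley m = with_proj \<lparr> pverts = UNIV,
     parcs = {(x, y). x \<noteq> y \<and> (\<exists>z. z \<noteq> 0 \<and> x - y = z ^ m)} \<rparr>"

definition cyclic_subgroup :: "'a::field \<Rightarrow> 'a set" where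
  "cyclic_subgroup g = range (\<lambda>k::int. g powi k)"

text \<open>\<open>cyclic_subgroup 0\<close> contains 0, so a primitive element is automatically non-zero.\<close>

definition primitive_element :: "'a::field \<Rightarrow> bool" where
  "primitive_element \<beta> \<longleftrightarrow> cyclic_subgroup \<beta> = UNIV - {0}"

text \<open>The coset \<open>Q\<^sub>i = \<omega>\<^sup>i Q\<^sub>0\<close>, where \<open>\<omega> = \<beta>\<^bsup>q-1\<^esup>\<close> and \<open>Q\<^sub>0\<close> is generated by \<open>\<omega>\<^sup>m\<close>.\<close>

definition Q_coset :: "'a::field \<Rightarrow> nat \<Rightarrow> nat \<Rightarrow> nat \<Rightarrow> 'a set" where
  "Q_coset \<beta> q m i =
     (let \<omega> = \<beta> ^ (q - 1) in (\<lambda>x. \<omega> ^ i * x) ` cyclic_subgroup (\<omega> ^ m))"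

text \<open>Complete bipartite graphs as in \<open>Graph_Theory.Kuratowski\<close>, but with the two parts given
  explicitly rather than only by their sizes.\<close>

definition complete_bipartite_parts :: "('a, 'b) pre_digraph \<Rightarrow> 'a set \<Rightarrow> 'a set \<Rightarrow> bool" where
  "complete_bipartite_parts G U V \<longleftrightarrow>
     graph G \<and> verts G = U \<union> V \<and> U \<inter> V = {} \<and> arcs_ends G = U \<times> V \<union> V \<times> U"

text \<open>Used for finite graphs only. The number \<open>\<theta>\<close> is an eigenvalue of \<open>G\<close> precisely when some
  \<open>f\<close> satisfies this, so it is not separately required to be one.\<close>

definition graph_eigenfunction :: "('a, 'b) pre_digraph \<Rightarrow> real \<Rightarrow> ('a \<Rightarrow> real) \<Rightarrow> bool" where
  "graph_eigenfunction G \<theta> f \<longleftrightarrow>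
     (\<exists>\<gamma>\<in>verts G. f \<gamma> \<noteq> 0) \<and>
     (\<forall>\<gamma>\<in>verts G. \<theta> * f \<gamma> = (\<Sum>\<delta> | \<gamma> \<rightarrow>\<^bsub>G\<^esub> \<delta>. f \<delta>))"

definition signed_indicator :: "'a set \<Rightarrow> 'a set \<Rightarrow> 'a \<Rightarrow> real" where
  "signed_indicator U V \<gamma> = (if \<gamma> \<in> U then 1 else if \<gamma> \<in> V then -1 else 0)"

text \<open>Adjacency is symmetric because \<open>-1\<close> is an \<open>m\<close>-th power.\<close>

lemma gen_paley_graph:
  fixes \<beta> :: "'a::{field,finite}"
  assumes card: "CARD('a) = q\<^sup>2" and odd: "odd q" and "m dvd q + 1"
    and prim: "primitive_element \<beta>"
  shows "graph (gen_paley m :: ('a, 'a \<times> 'a) pre_digraph)"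
proof -
  have nz: "\<beta> \<noteq> 0"
  proof
    assume "\<beta> = 0"
    then have "0 \<in> cyclic_subgroup \<beta>"
      unfolding cyclic_subgroup_def by (auto intro!: image_eqI[of _ _ 1])
    then show False using prim by (simp add: primitive_element_def)
  qed
  obtain c where c: "q + 1 = m * c" using assms(3) by auto
  obtain r where r: "q = 2 * r + 1" using odd by (elim oddE)
  have cardU: "card (UNIV - {0::'a}) = q\<^sup>2 - 1"
    using card by (simp add: card_Diff_singleton)
  have "card {0, 1::'a} \<le> CARD('a)" by (intro card_mono) auto
  then have q2: "q\<^sup>2 \<ge> 2" using card by simp
  define h where "h = m * (c * r)"
  have h2: "2 * h = q\<^sup>2 - 1"
  proof -
    have "2 * h = (q + 1) * (2 * r)" by (simp only: c h_def mult_ac)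
    then show ?thesis by (simp add: r power2_eq_square algebra_simps)
  qed
  then have h0: "h > 0" using q2 by simp
  have "(\<Prod>x\<in>UNIV - {0}. \<beta> * x) = (\<Prod>x\<in>UNIV - {0}. x)"
    using nz by (intro prod.reindex_bij_witness[where i = "\<lambda>x. x / \<beta>" and j = "\<lambda>x. \<beta> * x"]) auto
  then have "\<beta> ^ (2 * h) = 1" by (simp add: prod.distrib cardU h2)
  then have "(\<beta> ^ h)\<^sup>2 = 1" by (simp flip: power_mult add: mult.commute)
  moreover have "\<beta> ^ h \<noteq> 1"
  proof
    assume h1: "\<beta> ^ h = 1"
    have "\<beta> powi j = \<beta> ^ nat (j mod int h)" for j
    proof -
      have "\<beta> powi j = \<beta> powi (int h * (j div int h) + j mod int h)"
        by (simp only: mult_div_mod_eq)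
      also have "\<dots> = (\<beta> powi int h) powi (j div int h) * \<beta> powi (j mod int h)"
        by (subst power_int_add) (use nz in \<open>auto simp only: power_int_mult\<close>)
      also have "\<beta> powi int h = 1" using h1 by simp
      finally show ?thesis using h0 by (simp add: power_int_def)
    qed
    then have "cyclic_subgroup \<beta> \<subseteq> (\<lambda>n. \<beta> ^ n) ` {..<h}"
      unfolding cyclic_subgroup_def using h0 by (auto simp: nat_less_iff)
    then have "card (UNIV - {0::'a}) \<le> h"
      using prim surj_card_le[of "{..<h}" _ "\<lambda>n. \<beta> ^ n"]
      unfolding primitive_element_def
      by (metis card_lessThan finite_lessThan)
    then show False using cardU h2 h0 by simp
  qed
  ultimately have "\<beta> ^ h = -1" by (simp add: power2_eq_1_iff)
  then obtain w where w: "w \<noteq> 0" "w ^ m = (-1 :: 'a)"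
    using nz by (intro that[of "\<beta> ^ (c * r)"]) (auto simp: h_def mult.commute simp flip: power_mult)
  have "sym (arcs_ends (gen_paley m :: ('a, 'a \<times> 'a) pre_digraph))"
  proof (rule symI)
    fix x y :: 'a assume "x \<rightarrow>\<^bsub>gen_paley m\<^esub> y"
    then obtain z where "x \<noteq> y" "z \<noteq> 0" "x - y = z ^ m" by (auto simp: gen_paley_def)
    moreover from this have "y - x = (w * z) ^ m"
      using w by (simp add: power_mult_distrib) (metis minus_diff_eq)
    ultimately show "y \<rightarrow>\<^bsub>gen_paley m\<^esub> x"
      using w by (auto simp: gen_paley_def intro!: exI[of _ "w * z"])
  qed
  then show ?thesis
    by unfold_locales (auto simp: gen_paley_def symmetric_def arc_to_ends_def)
qed

end

theory Submission
  imports Defs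
begin

text \<open>
  Put \<open>c = (q + 1) / m\<close>. For \<open>t \<in> Q\<^sub>0\<close> the additive map \<open>x \<mapsto> x\<^sup>q - t x\<close> has as fibres the affine
  \<open>\<bbbF>\<^sub>q\<close>-lines of one direction, and two distinct points are adjacent iff they lie on a common line of
  one of these \<open>c\<close> parallel classes. Writing \<open>A\<close> for the adjacency matrix, \<open>A + c I\<close> is the sum over
  the parallel classes of the (positive semidefinite) matrices of the relation of lying on a common
  line. Hence the eigenfunctions for \<open>-c\<close> are exactly the functions whose sum over each of these
  lines vanishes. A point where such a function is positive has, on each of the \<open>c\<close> lines through it,
  a point where it is negative, which gives the bound \<open>2 c\<close>. In a complete bipartite induced
  subgraph with parts of size \<open>c\<close>, the \<open>c\<close> neighbours of a vertex lie on distinct lines, so each line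
  meets both parts in one point or neither of them.
\<close>

section \<open>Point graphs of parallel classes\<close>

text \<open>The lines of class \<open>t\<close> are encoded as the fibres of
  \<open>\<phi> t\<close>, so those of one class partition the points by construction. Together with
  \<open>class_unique\<close>, this makes lines of different classes meet in at most one
  point.\<close>

locale parallel_classes =
  fixes T :: "'t set" and \<phi> :: "'t \<Rightarrow> 'v::finite \<Rightarrow> 'b" and adj :: "'v \<Rightarrow> 'v \<Rightarrow> bool"
  assumes finite_T: "finite T"
    and adj_iff: "adj x y \<longleftrightarrow> x \<noteq> y \<and> (\<exists>t\<in>T. \<phi> t x = \<phi> t y)"
    and class_unique: "\<lbrakk>x \<noteq> y; s \<in> T; t \<in> T; \<phi> s x = \<phi> s y; \<phi> t x = \<phi> t y\<rbrakk> \<Longrightarrow> s = t"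
begin

text \<open>Each neighbour of \<open>x\<close> lies on exactly one of the lines through
  \<open>x\<close>, while \<open>x\<close> itself lies on all \<open>card T\<close> of them and has
  to be subtracted that often.\<close>

lemma neighbour_sum:
  fixes g :: "'v \<Rightarrow> real"
  shows "(\<Sum>y | adj x y. g y) = (\<Sum>t\<in>T. \<Sum>y | \<phi> t y = \<phi> t x. g y) - real (card T) * g x"
proof -
  have "{y. adj x y} = (\<Union>t\<in>T. {y. \<phi> t y = \<phi> t x} - {x})"
    by (auto simp: adj_iff eq_commute)
  then have "(\<Sum>y | adj x y. g y) = (\<Sum>t\<in>T. \<Sum>y \<in> {y. \<phi> t y = \<phi> t x} - {x}. g y)"
    using finite_T class_unique[of x]
    by (simp only:) (rule sum.UNION_disjoint, simp, simp, fastforce)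
  also have "\<dots> = (\<Sum>t\<in>T. (\<Sum>y | \<phi> t y = \<phi> t x. g y) - g x)"
    by (simp add: sum_diff1)
  finally show ?thesis
    by (simp add: sum_subtractf)
qed

text \<open>This is the positive semidefiniteness of the same-line relation of one class: grouping
  the points by fibre turns its quadratic form into a sum of squares.\<close>

lemma sum_fibre_products:
  fixes g :: "'v \<Rightarrow> real"
  shows "(\<Sum>x\<in>UNIV. g x * (\<Sum>y | \<phi> t y = \<phi> t x. g y))
    = (\<Sum>v\<in>range (\<phi> t). (\<Sum>x | \<phi> t x = v. g x)\<^sup>2)"
proof -
  have "(\<Sum>x\<in>UNIV. g x * (\<Sum>y | \<phi> t y = \<phi> t x. g y))
    = (\<Sum>v\<in>range (\<phi> t). \<Sum>x | x \<in> UNIV \<and> \<phi> t x = v. g x * (\<Sum>y | \<phi> t y = \<phi> t x. g y))"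
    by (rule sum.image_gen) simp
  also have "\<dots> = (\<Sum>v\<in>range (\<phi> t). (\<Sum>x | \<phi> t x = v. g x)\<^sup>2)"
    by (rule sum.cong) (auto simp: power2_eq_square sum_distrib_right intro!: sum.cong)
  finally show ?thesis .
qed

lemma eigen_iff_line_sums_zero:
  fixes g :: "'v \<Rightarrow> real"
  shows "(\<forall>x. - real (card T) * g x = (\<Sum>y | adj x y. g y))
    \<longleftrightarrow> (\<forall>t\<in>T. \<forall>x. (\<Sum>y | \<phi> t y = \<phi> t x. g y) = 0)"
proof
  assume eigen: "\<forall>x. - real (card T) * g x = (\<Sum>y | adj x y. g y)"
  then have "(\<Sum>t\<in>T. \<Sum>y | \<phi> t y = \<phi> t x. g y) = 0" for x
    using neighbour_sum[of g x] by (smt (verit) mult_minus_left)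
  \<comment> \<open>So far only the total over all classes vanishes at each point. Pairing with
    \<open>g\<close> gives a vanishing sum of squares, which forces every single line sum to be
    zero.\<close>
  then have "0 = (\<Sum>x\<in>UNIV. g x * (\<Sum>t\<in>T. \<Sum>y | \<phi> t y = \<phi> t x. g y))"
    by simp
  also have "\<dots> = (\<Sum>t\<in>T. \<Sum>x\<in>UNIV. g x * (\<Sum>y | \<phi> t y = \<phi> t x. g y))"
    by (subst sum.swap) (simp add: sum_distrib_left)
  also have "\<dots> = (\<Sum>t\<in>T. \<Sum>v\<in>range (\<phi> t). (\<Sum>x | \<phi> t x = v. g x)\<^sup>2)"
    by (simp add: sum_fibre_products)
  finally have "\<forall>t\<in>T. (\<Sum>v\<in>range (\<phi> t). (\<Sum>x | \<phi> t x = v. g x)\<^sup>2) = 0"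
    using finite_T by (subst (asm) eq_commute, subst (asm) sum_nonneg_eq_0_iff) (auto intro: sum_nonneg)
  then show "\<forall>t\<in>T. \<forall>x. (\<Sum>y | \<phi> t y = \<phi> t x. g y) = 0"
    by (subst (asm) sum_nonneg_eq_0_iff) auto
next
  assume "\<forall>t\<in>T. \<forall>x. (\<Sum>y | \<phi> t y = \<phi> t x. g y) = 0"
  then show "\<forall>x. - real (card T) * g x = (\<Sum>y | adj x y. g y)"
    by (simp add: neighbour_sum)
qed

text \<open>On each line through \<open>x\<close> the positive value at \<open>x\<close> must be
  compensated by a negative one. Points chosen on different lines differ, since two such lines share
  only \<open>x\<close>.\<close>

lemma card_negative_ge:
  fixes g :: "'v \<Rightarrow> real"
  assumes zero: "\<And>t x. t \<in> T \<Longrightarrow> (\<Sum>y | \<phi> t y = \<phi> t x. g y) = 0" and pos: "g x > 0"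
  shows "card T \<le> card {y. g y < 0}"
proof -
  have "\<exists>y. \<phi> t y = \<phi> t x \<and> g y < 0" if "t \<in> T" for t
  proof (rule ccontr)
    assume "\<nexists>y. \<phi> t y = \<phi> t x \<and> g y < 0"
    then have "g x = 0"
      using zero[OF that, of x] by (subst (asm) sum_nonneg_eq_0_iff) (auto simp: not_less)
    then show False using pos by simp
  qed
  then obtain w where w: "\<And>t. t \<in> T \<Longrightarrow> \<phi> t (w t) = \<phi> t x \<and> g (w t) < 0"
    by metis
  have "inj_on w T"
  proof (rule inj_onI)
    fix s t assume "s \<in> T" "t \<in> T" "w s = w t"
    \<comment> \<open>The signs of \<open>g\<close> at \<open>w s\<close> and at \<open>x\<close>
      differ, so these points are distinct, as \<open>class_unique\<close> requires.\<close>
    with w[of s] w[of t] pos show "s = t"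
      by (intro class_unique[of "w s" x]) auto
  qed
  then show ?thesis
    using w by (intro card_inj_on_le[of w]) auto
qed

lemma card_support_ge:
  fixes g :: "'v \<Rightarrow> real"
  assumes zero: "\<And>t x. t \<in> T \<Longrightarrow> (\<Sum>y | \<phi> t y = \<phi> t x. g y) = 0" and "g x \<noteq> 0"
  shows "2 * card T \<le> card {y. g y \<noteq> 0}"
proof (cases "T = {}")
  case False
  have zero': "(\<Sum>y | \<phi> t y = \<phi> t x. - g y) = 0" if "t \<in> T" for t x
    using zero[OF that, of x] by (simp add: sum_negf)
  have neg: "card T \<le> card {y. g y < 0}" if "g x > 0" for x
    using card_negative_ge[of g x] zero that by blast
  have pos: "card T \<le> card {y. g y > 0}" if "g x < 0" for x
    using card_negative_ge[of "\<lambda>y. - g y" x] zero' that by simp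
  have "card T > 0"
    using False finite_T by (simp add: card_gt_0_iff)
  \<comment> \<open>As there is at least one class, either sign forces the other, so the one-sided
    bound applies to both \<open>g\<close> and its negative.\<close>
  then have "\<exists>x. g x < 0" if "g x > 0" for x
    using neg[OF that] by (cases "{y. g y < 0} = {}") auto
  moreover have "\<exists>x. g x > 0" if "g x < 0" for x
    using pos[OF that] \<open>card T > 0\<close> by (cases "{y. g y > 0} = {}") auto
  ultimately have "card T \<le> card {y. g y < 0}" "card T \<le> card {y. g y > 0}"
    using neg pos \<open>g x \<noteq> 0\<close> by (metis linorder_neqE_linordered_idom)+
  moreover have "card {y. g y \<noteq> 0} = card {y. g y < 0} + card {y. g y > 0}"
    by (subst card_Un_disjoint[symmetric]) (auto intro!: arg_cong[where f = card])
  ultimately show ?thesis by simp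
qed simp

text \<open>Send each \<open>v\<close> in \<open>V\<close> to the class of the line joining it to
  \<open>u\<close>. Two points with the same image would lie on one line through \<open>u\<close>
  and be adjacent, so the map is injective, and equal cardinalities make it onto
  \<open>T\<close>.\<close>

lemma line_meets_other_part:
  assumes "card V = card T" and complete: "\<And>v. v \<in> V \<Longrightarrow> adj u v"
    and indep: "\<And>v w. v \<in> V \<Longrightarrow> w \<in> V \<Longrightarrow> \<not> adj v w" and "t \<in> T"
  shows "\<exists>v\<in>V. \<phi> t v = \<phi> t u"
proof -
  obtain d where d: "\<And>v. v \<in> V \<Longrightarrow> d v \<in> T \<and> \<phi> (d v) u = \<phi> (d v) v"
    using complete unfolding adj_iff by metis
  have "inj_on d V"
  proof (rule inj_onI)
    fix v w assume "v \<in> V" "w \<in> V" "d v = d w"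
    then show "v = w"
      using d[of v] d[of w] indep[of v w] by (auto simp: adj_iff)
  qed
  moreover have "d ` V \<subseteq> T"
    using d by auto
  ultimately have "d ` V = T"
    using assms(1) finite_T by (intro card_subset_eq) (auto simp: card_image)
  then show ?thesis
    using d \<open>t \<in> T\<close> by force
qed

lemma bipartite_line_sum_zero:
  assumes cards: "card U = card T" "card V = card T" and disjoint: "U \<inter> V = {}"
    and complete: "\<And>u v. u \<in> U \<Longrightarrow> v \<in> V \<Longrightarrow> adj u v"
    and indepU: "\<And>v w. v \<in> U \<Longrightarrow> w \<in> U \<Longrightarrow> \<not> adj v w"
    and indepV: "\<And>v w. v \<in> V \<Longrightarrow> w \<in> V \<Longrightarrow> \<not> adj v w" and t: "t \<in> T"
  shows "(\<Sum>y | \<phi> t y = \<phi> t x. signed_indicator U V y) = 0"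
proof -
  let ?L = "{y. \<phi> t y = \<phi> t x}"
  \<comment> \<open>Disjointness makes the nested conditional a difference of indicators, which
    reduces the claim to the line meeting both parts equally often.\<close>
  have indicator: "signed_indicator U V y = of_bool (y \<in> U) - of_bool (y \<in> V)" for y
    using disjoint by (auto simp: signed_indicator_def)
  have "card (W \<inter> ?L) \<le> Suc 0" if indep: "\<And>v w. v \<in> W \<Longrightarrow> w \<in> W \<Longrightarrow> \<not> adj v w" for W
  proof -
    have "v = w" if "v \<in> W \<inter> ?L" "w \<in> W \<inter> ?L" for v w
      using indep[of v w] that t by (auto simp: adj_iff)
    then show ?thesis by (simp add: card_le_Suc0_iff_eq)
  qed
  then have "card (U \<inter> ?L) \<le> Suc 0" "card (V \<inter> ?L) \<le> Suc 0"
    using indepU indepV by blast+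
  moreover have "U \<inter> ?L = {} \<longleftrightarrow> V \<inter> ?L = {}"
  proof -
    have "\<exists>v\<in>V. \<phi> t v = \<phi> t u" if "u \<in> U" for u
      using line_meets_other_part[of V u t] cards complete indepV t that by blast
    moreover have "\<exists>u\<in>U. \<phi> t u = \<phi> t v" if "v \<in> V" for v
    proof (rule line_meets_other_part)
      show "adj v u" if "u \<in> U" for u
        using complete[OF that \<open>v \<in> V\<close>] by (metis adj_iff)
    qed (use cards indepU t in auto)
    ultimately show ?thesis by force
  qed
  moreover have "card A = card B" if "card A \<le> Suc 0" "card B \<le> Suc 0" "A = {} \<longleftrightarrow> B = {}"
    for A B :: "'v set"
  proof -
    have "card A = 0 \<longleftrightarrow> card B = 0" using that(3) by simp
    then show ?thesis using that(1,2) by linarith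
  qed
  ultimately have "card (U \<inter> ?L) = card (V \<inter> ?L)" by blast
  then show ?thesis
    by (simp add: indicator sum_subtractf Int_commute)
qed

end


section \<open>Finite fields\<close>

lemma finite_field_power_card_minus_1:
  fixes x :: "'a::{field,finite}"
  assumes "x \<noteq> 0"
  shows "x ^ (CARD('a) - 1) = 1"
proof -
  have "(\<Prod>y\<in>UNIV - {0}. x * y) = (\<Prod>y\<in>UNIV - {0}. y)"
    using assms by (intro prod.reindex_bij_witness[where i = "\<lambda>y. y / x" and j = "\<lambda>y. x * y"]) auto
  then show ?thesis
    by (simp add: prod.distrib card_Diff_singleton)
qed

lemma card_field_gt_1: "CARD('a::{field,finite}) > 1"
  using card_mono[of UNIV "{0, 1::'a}"] by simp

lemma cyclic_subgroup_eq_range_power: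
  fixes g :: "'a::{field,finite}"
  assumes "g \<noteq> 0"
  shows "cyclic_subgroup g = range (\<lambda>k::nat. g ^ k)"
proof
  show "cyclic_subgroup g \<subseteq> range (\<lambda>k::nat. g ^ k)"
  proof
    fix x assume "x \<in> cyclic_subgroup g"
    then obtain k :: int where k: "x = g powi k"
      by (auto simp: cyclic_subgroup_def)
    show "x \<in> range (\<lambda>k::nat. g ^ k)"
    proof (cases k)
      case (nonneg n)
      then show ?thesis using k by simp
    next
      case (neg n)
      \<comment> \<open>A negative power is rewritten as a positive one: the inverse of
        \<open>g\<close> is \<open>g\<close> to the \<open>CARD('a) - 2\<close>. The truncated
        subtraction is harmless because a field has at least two elements.\<close>
      have "CARD('a) - 1 = Suc (CARD('a) - 2)"
        using card_field_gt_1[where 'a = 'a] by linarith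
      then have "Suc n + Suc n * (CARD('a) - 2) = (CARD('a) - 1) * Suc n"
        by (simp only: mult_Suc mult_Suc_right mult.commute)
      then have "g ^ Suc n * g ^ (Suc n * (CARD('a) - 2)) = (g ^ (CARD('a) - 1)) ^ Suc n"
        by (simp only: flip: power_add power_mult)
      also have "\<dots> = 1"
        by (simp only: finite_field_power_card_minus_1[OF assms] power_one)
      finally have "inverse (g ^ Suc n) = g ^ (Suc n * (CARD('a) - 2))"
        by (rule inverse_unique)
      moreover have "x = inverse (g ^ Suc n)"
        unfolding k neg by (simp only: power_int_minus power_int_of_nat)
      ultimately show ?thesis by blast
    qed
  qed
  show "range (\<lambda>k::nat. g ^ k) \<subseteq> cyclic_subgroup g"
    unfolding cyclic_subgroup_def by (metis power_int_of_nat image_subsetI rangeI)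
qed

lemma primitive_element_nonzero:
  assumes "primitive_element \<beta>"
  shows "\<beta> \<noteq> 0"
proof
  assume "\<beta> = 0"
  then have "0 \<in> cyclic_subgroup \<beta>"
    unfolding cyclic_subgroup_def by (auto intro!: range_eqI[of _ _ 1])
  then show False using assms by (simp add: primitive_element_def)
qed

lemma primitive_element_powerE:
  fixes \<beta> x :: "'a::{field,finite}"
  assumes "primitive_element \<beta>" "x \<noteq> 0"
  obtains k :: nat where "x = \<beta> ^ k"
  using assms cyclic_subgroup_eq_range_power[OF primitive_element_nonzero[OF assms(1)]]
  by (auto simp: primitive_element_def)

lemma primitive_element_power_eq_iff:
  fixes \<beta> :: "'a::{field,finite}"
  assumes prim: "primitive_element \<beta>"
  shows "\<beta> ^ i = \<beta> ^ j \<longleftrightarrow> i mod (CARD('a) - 1) = j mod (CARD('a) - 1)"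
proof -
  define N where "N = CARD('a) - 1"
  have nz: "\<beta> \<noteq> 0" by (rule primitive_element_nonzero[OF prim])
  have N: "N > 0" using card_field_gt_1[where 'a = 'a] by (simp add: N_def)
  have red: "\<beta> ^ k = \<beta> ^ (k mod N)" for k
  proof -
    have "\<beta> ^ k = \<beta> ^ (N * (k div N) + k mod N)" by simp
    also have "\<dots> = \<beta> ^ (k mod N)"
      unfolding power_add power_mult N_def finite_field_power_card_minus_1[OF nz] by simp
    finally show ?thesis .
  qed
  have "UNIV - {0} = (\<lambda>k. \<beta> ^ k) ` {..<N}"
  proof (intro equalityI subsetI)
    fix x :: 'a assume "x \<in> UNIV - {0}"
    then obtain k where "x = \<beta> ^ k" using primitive_element_powerE[OF prim, of x] by auto
    then show "x \<in> (\<lambda>k. \<beta> ^ k) ` {..<N}"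
      using red[of k] N by (auto intro!: image_eqI[of _ _ "k mod N"])
  qed (use nz in auto)
  \<comment> \<open>The \<open>N\<close> exponents below \<open>N\<close> hit all \<open>N\<close>
    non-zero elements, so by counting no two of them give the same power.\<close>
  then have "card ((\<lambda>k. \<beta> ^ k) ` {..<N}) = card {..<N}"
    by (simp only: flip: \<open>UNIV - {0} = _\<close>) (simp add: N_def card_Diff_singleton)
  then have "inj_on (\<lambda>k. \<beta> ^ k) {..<N}"
    by (intro eq_card_imp_inj_on) auto
  then have "\<beta> ^ (i mod N) = \<beta> ^ (j mod N) \<longleftrightarrow> i mod N = j mod N"
    using N by (auto simp: inj_on_def)
  then show ?thesis using red[of i] red[of j] by (simp add: N_def)
qed

lemma card_cyclic_subgroup_power:
  fixes \<beta> :: "'a::{field,finite}"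
  assumes prim: "primitive_element \<beta>" and dc: "CARD('a) - 1 = d * c"
  shows "card (cyclic_subgroup (\<beta> ^ d)) = c"
proof -
  have pos: "d * c > 0"
    using card_field_gt_1[where 'a = 'a] dc by linarith
  have "cyclic_subgroup (\<beta> ^ d) = (\<lambda>k. \<beta> ^ (d * k)) ` {..<c}"
  proof -
    have "\<beta> ^ (d * k) = \<beta> ^ (d * (k mod c))" for k
      unfolding primitive_element_power_eq_iff[OF prim] dc by (simp flip: mult_mod_right)
    moreover have "k mod c \<in> {..<c}" for k
      using pos by simp
    ultimately have "range (\<lambda>k. \<beta> ^ (d * k)) = (\<lambda>k. \<beta> ^ (d * k)) ` {..<c}"
      by blast
    then show ?thesis
      using primitive_element_nonzero[OF prim]
      by (simp add: cyclic_subgroup_eq_range_power power_mult)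
  qed
  moreover have "inj_on (\<lambda>k. \<beta> ^ (d * k)) {..<c}"
    unfolding inj_on_def primitive_element_power_eq_iff[OF prim] dc
    using pos by (auto simp flip: mult_mod_right)
  ultimately show ?thesis
    by (simp add: card_image)
qed

text \<open>Translation by 1 permutes the field; comparing the sums of all elements shows that the
  cardinality vanishes in the field, so the prime characteristic divides a power of
  \<open>p\<close>.\<close>

lemma CHAR_eq_of_card_eq_prime_power:
  assumes "prime p" and "CARD('a::{field,finite}) = p ^ k"
  shows "CHAR('a) = p"
proof -
  have "(\<Sum>x\<in>(UNIV::'a set). x) = (\<Sum>x\<in>UNIV. x + 1)"
    by (rule sum.reindex_bij_witness[where i = "\<lambda>x. x + 1" and j = "\<lambda>x. x - 1"]) auto
  then have "of_nat (p ^ k) = (0 :: 'a)"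
    using assms(2) by (simp add: sum.distrib)
  then have "CHAR('a) dvd p ^ k"
    by (simp only: of_nat_eq_0_iff_char_dvd)
  moreover have "prime CHAR('a)"
    by (intro prime_CHAR_semidom finite_imp_CHAR_pos) simp
  ultimately show ?thesis
    using assms(1) by (metis prime_dvd_power primes_dvd_imp_eq)
qed

lemma power_diff_CHAR_power:
  fixes x y :: "'a::{field,finite}"
  assumes "prime p" and "CARD('a) = (p ^ n)\<^sup>2"
  shows "(x - y) ^ (p ^ n) = x ^ (p ^ n) - y ^ (p ^ n)"
proof -
  have "CHAR('a) = p"
    using CHAR_eq_of_card_eq_prime_power[of p "n * 2"] assms by (simp add: power_mult)
  \<comment> \<open>Applying additivity of the Frobenius power to \<open>(x - y) + y\<close> avoids
    any discussion of the sign of \<open>(-1) ^ (p ^ n)\<close>.\<close>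
  then have "(x - y + y) ^ (p ^ n) = (x - y) ^ (p ^ n) + y ^ (p ^ n)"
    using assms(1) by (intro freshmans_dream') auto
  then show ?thesis by simp
qed


section \<open>Generalised Paley graphs\<close>

lemma gen_paley_arc_iff:
  fixes x y :: "'a::{field,finite}"
  shows "x \<rightarrow>\<^bsub>gen_paley m\<^esub> y \<longleftrightarrow> x \<noteq> y \<and> (\<exists>z. z \<noteq> 0 \<and> x - y = z ^ m)"
  by (auto simp: gen_paley_def)

text \<open>Raising to the power \<open>q - 1\<close> kills the non-zero elements of the subfield of
  order \<open>q\<close>, so it records only the direction of \<open>x - y\<close>. This loses
  nothing about being an \<open>m\<close>-th power, because \<open>m\<close> divides
  \<open>q + 1\<close>.\<close>

lemma gen_paley_arc_iff_cyclic_subgroup: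
  fixes \<beta> x y :: "'a::{field,finite}"
  assumes card: "CARD('a) = q\<^sup>2" and prim: "primitive_element \<beta>" and m: "m dvd q + 1"
  shows "x \<rightarrow>\<^bsub>gen_paley m\<^esub> y
    \<longleftrightarrow> x \<noteq> y \<and> (x - y) ^ (q - 1) \<in> cyclic_subgroup ((\<beta> ^ (q - 1)) ^ m)"
proof -
  have nz: "\<beta> \<noteq> 0" by (rule primitive_element_nonzero[OF prim])
  have q: "q > 1"
    using card_field_gt_1[where 'a = 'a] card by (intro power_less_imp_less_base[of 1 2]) auto
  have N: "CARD('a) - 1 = (q - 1) * (q + 1)"
    using q card by (cases q) (auto simp: power2_eq_square)
  have sub: "cyclic_subgroup ((\<beta> ^ (q - 1)) ^ m) = range (\<lambda>j. \<beta> ^ ((q - 1) * (m * j)))"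
    using nz by (simp add: cyclic_subgroup_eq_range_power power_mult)
  have "(\<exists>z. z \<noteq> 0 \<and> x - y = z ^ m) \<longleftrightarrow> (x - y) ^ (q - 1) \<in> range (\<lambda>j. \<beta> ^ ((q - 1) * (m * j)))"
    if "x \<noteq> y"
  proof
    assume "\<exists>z. z \<noteq> 0 \<and> x - y = z ^ m"
    then obtain z where z: "z \<noteq> 0" "x - y = z ^ m" by blast
    then obtain j where "z = \<beta> ^ j" using primitive_element_powerE[OF prim] by blast
    then have "(x - y) ^ (q - 1) = \<beta> ^ ((q - 1) * (m * j))"
      by (simp add: z(2) mult_ac flip: power_mult)
    then show "(x - y) ^ (q - 1) \<in> range (\<lambda>j. \<beta> ^ ((q - 1) * (m * j)))" by blast
  next
    assume "(x - y) ^ (q - 1) \<in> range (\<lambda>j. \<beta> ^ ((q - 1) * (m * j)))"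
    then obtain j where j: "(x - y) ^ (q - 1) = \<beta> ^ ((q - 1) * (m * j))" by blast
    have "x - y \<noteq> 0" using that by simp
    then obtain k where k: "x - y = \<beta> ^ k"
      by (rule primitive_element_powerE[OF prim])
    have "\<beta> ^ ((q - 1) * k) = \<beta> ^ ((q - 1) * (m * j))"
      using j by (simp add: k mult.commute flip: power_mult)
    \<comment> \<open>The exponents agree modulo \<open>(q - 1) * (q + 1)\<close>; cancelling
      \<open>q - 1\<close> leaves a congruence modulo \<open>q + 1\<close>, hence modulo
      \<open>m\<close>, so \<open>m\<close> divides \<open>k\<close>.\<close>
    then have "k mod (q + 1) = (m * j) mod (q + 1)"
      unfolding primitive_element_power_eq_iff[OF prim] N mult_mod_right[symmetric] using q by simp
    then have "k mod m = (m * j) mod m"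
      using m by (metis mod_mod_cancel)
    then obtain l where "k = m * l" by auto
    then show "\<exists>z. z \<noteq> 0 \<and> x - y = z ^ m"
      using k nz by (intro exI[of _ "\<beta> ^ l"]) (simp add: mult.commute flip: power_mult)
  qed
  then show ?thesis
    unfolding gen_paley_arc_iff sub by blast
qed

lemma parallel_classes_gen_paley:
  fixes \<beta> :: "'a::{field,finite}"
  assumes p: "prime p" and q: "q = p ^ n" and card: "CARD('a) = q\<^sup>2"
    and prim: "primitive_element \<beta>" and m: "m dvd q + 1"
  shows "parallel_classes (cyclic_subgroup ((\<beta> ^ (q - 1)) ^ m)) (\<lambda>t x. x ^ q - t * x)
    (\<lambda>x y. x \<rightarrow>\<^bsub>gen_paley m\<^esub> y)"
proof -
  have "q > 0" using p q by (simp add: prime_gt_0_nat)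
  \<comment> \<open>By additivity of the \<open>q\<close>-th power, equal values mean
    \<open>(x - y) ^ q = t * (x - y)\<close>. Cancelling \<open>x - y\<close> shows that
    \<open>t\<close> is determined by the two points, which gives uniqueness of the class.\<close>
  have class_iff: "x ^ q - t * x = y ^ q - t * y \<longleftrightarrow> (x - y) ^ (q - 1) = t" if "x \<noteq> y" for x y t :: 'a
  proof -
    have "(x - y) ^ q = x ^ q - y ^ q"
      using power_diff_CHAR_power[of p n x y] p q card by simp
    moreover have "a - t * x = b - t * y \<longleftrightarrow> a - b = t * (x - y)" for a b
      by (simp add: algebra_simps)
    ultimately have "x ^ q - t * x = y ^ q - t * y \<longleftrightarrow> (x - y) ^ q = t * (x - y)"
      by simp
    also have "(x - y) ^ q = (x - y) ^ (q - 1) * (x - y)"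
      using \<open>q > 0\<close> by (simp only: power_minus_mult)
    finally show ?thesis using that by simp
  qed
  show ?thesis
  proof
    show "x \<rightarrow>\<^bsub>gen_paley m\<^esub> y \<longleftrightarrow> x \<noteq> y \<and>
        (\<exists>t\<in>cyclic_subgroup ((\<beta> ^ (q - 1)) ^ m). x ^ q - t * x = y ^ q - t * y)" for x y :: 'a
      using gen_paley_arc_iff_cyclic_subgroup[OF card prim m, of x y]
      by (cases "x = y") (auto simp: class_iff)
  qed (use class_iff in auto)
qed

lemma complete_bipartite_parts_induced:
  assumes "complete_bipartite_parts (G \<restriction> (U \<union> V)) U V"
  shows "U \<inter> V = {}"
    and "u \<in> U \<Longrightarrow> v \<in> V \<Longrightarrow> u \<rightarrow>\<^bsub>G\<^esub> v"
    and "u \<in> U \<Longrightarrow> v \<in> U \<Longrightarrow> \<not> u \<rightarrow>\<^bsub>G\<^esub> v"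
    and "u \<in> V \<Longrightarrow> v \<in> V \<Longrightarrow> \<not> u \<rightarrow>\<^bsub>G\<^esub> v"
proof -
  show disjoint: "U \<inter> V = {}"
    using assms by (simp add: complete_bipartite_parts_def)
  have ends: "arcs_ends (G \<restriction> (U \<union> V)) = U \<times> V \<union> V \<times> U"
    using assms by (simp add: complete_bipartite_parts_def)
  have induced: "u \<rightarrow>\<^bsub>G \<restriction> (U \<union> V)\<^esub> v \<longleftrightarrow> u \<rightarrow>\<^bsub>G\<^esub> v" if "u \<in> U \<union> V" "v \<in> U \<union> V" for u v
    using that by (auto simp: arcs_ends_conv)
  show "u \<in> U \<Longrightarrow> v \<in> V \<Longrightarrow> u \<rightarrow>\<^bsub>G\<^esub> v"
    and "u \<in> U \<Longrightarrow> v \<in> U \<Longrightarrow> \<not> u \<rightarrow>\<^bsub>G\<^esub> v"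
    and "u \<in> V \<Longrightarrow> v \<in> V \<Longrightarrow> \<not> u \<rightarrow>\<^bsub>G\<^esub> v"
    using induced[of u v] disjoint by (auto simp: ends)
qed

theorem theorem4p3:
  fixes \<beta> :: "'a::{field,finite}" and p n q m i\<^sub>1 i\<^sub>2 :: nat
  assumes "prime p" and "odd p" and "n \<ge> 1" and "q = p ^ n"
    and "CARD('a) = q\<^sup>2"
    and "primitive_element \<beta>"
    and "m \<ge> 3" and "m dvd q + 1"
    and "i\<^sub>1 < i\<^sub>2" and "i\<^sub>2 \<le> m - 1"
    and "complete_bipartite_parts
           (gen_paley m \<restriction> (Q_coset \<beta> q m i\<^sub>1 \<union> Q_coset \<beta> q m i\<^sub>2))
           (Q_coset \<beta> q m i\<^sub>1) (Q_coset \<beta> q m i\<^sub>2)"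
  defines "f \<equiv> signed_indicator (Q_coset \<beta> q m i\<^sub>1) (Q_coset \<beta> q m i\<^sub>2)"
  shows "graph_eigenfunction (gen_paley m) (- (real (q + 1) / real m)) f
       \<and> real (card {\<gamma>. f \<gamma> \<noteq> 0}) = 2 * real (q + 1) / real m
       \<and> (\<forall>g :: 'a \<Rightarrow> real. graph_eigenfunction (gen_paley m) (- (real (q + 1) / real m)) g
             \<longrightarrow> real (card {\<gamma>. g \<gamma> \<noteq> 0}) \<ge> 2 * real (q + 1) / real m)"
proof -
  define T where "T = cyclic_subgroup ((\<beta> ^ (q - 1)) ^ m)"
  define \<phi> where "\<phi> = (\<lambda>t x :: 'a. x ^ q - t * x)"
  define U where "U = Q_coset \<beta> q m i\<^sub>1"
  define V where "V = Q_coset \<beta> q m i\<^sub>2"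
  interpret parallel_classes T \<phi> "\<lambda>x y. x \<rightarrow>\<^bsub>gen_paley m\<^esub> y"
    unfolding T_def \<phi>_def by (rule parallel_classes_gen_paley) fact+
  have nz: "\<beta> \<noteq> 0" by (rule primitive_element_nonzero) fact
  obtain c where c: "q + 1 = m * c" using \<open>m dvd q + 1\<close> by blast
  have "q > 0" using \<open>prime p\<close> \<open>q = p ^ n\<close> by (simp add: prime_gt_0_nat)
  then have "CARD('a) - 1 = (q - 1) * (q + 1)"
    using \<open>CARD('a) = q\<^sup>2\<close> by (cases q) (auto simp: power2_eq_square)
  \<comment> \<open>The generator of \<open>T\<close> is \<open>\<beta> ^ ((q - 1) * m)\<close>, so
    this factorisation gives its order as the cofactor \<open>c\<close>.\<close>
  then have "CARD('a) - 1 = ((q - 1) * m) * c"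
    by (simp only: c mult.assoc)
  then have cardT: "card T = c"
    using card_cyclic_subgroup_power[of \<beta> "(q - 1) * m" c] \<open>primitive_element \<beta>\<close>
    by (simp add: T_def power_mult)
  have c_real: "real (q + 1) / real m = real (card T)"
    unfolding c cardT using \<open>m \<ge> 3\<close> by simp
  have "card (Q_coset \<beta> q m i) = card T" for i
    unfolding Q_coset_def Let_def T_def using nz by (intro card_image) (auto simp: inj_on_def)
  then have cards: "card U = card T" "card V = card T"
    by (simp_all add: U_def V_def)
  have "complete_bipartite_parts (gen_paley m \<restriction> (U \<union> V)) U V"
    unfolding U_def V_def by fact
  note bip = complete_bipartite_parts_induced[OF this]
  \<comment> \<open>With \<open>card T\<close> equal to \<open>(q + 1) / m\<close>, both the
    eigenfunction claim and the lower bound become statements about line sums.\<close>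
  have eigen_iff: "graph_eigenfunction (gen_paley m) (- real (card T)) g \<longleftrightarrow>
      (\<exists>x. g x \<noteq> 0) \<and> (\<forall>t\<in>T. \<forall>x. (\<Sum>y | \<phi> t y = \<phi> t x. g y) = 0)" for g :: "'a \<Rightarrow> real"
    unfolding eigen_iff_line_sums_zero[symmetric]
    by (simp add: graph_eigenfunction_def gen_paley_def)
  have f: "f = signed_indicator U V" by (simp add: f_def U_def V_def)
  have supp: "{\<gamma>. f \<gamma> \<noteq> 0} = U \<union> V" by (auto simp: f signed_indicator_def)
  have cardf: "card {\<gamma>. f \<gamma> \<noteq> 0} = 2 * card T"
    unfolding supp using bip(1) cards by (simp add: card_Un_disjoint)
  moreover have "c > 0" using c by (cases c) auto
  ultimately have "\<exists>x. f x \<noteq> 0"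
    using cardT by (cases "{x. f x \<noteq> 0} = {}") auto
  moreover have "(\<Sum>y | \<phi> t y = \<phi> t x. f y) = 0" if "t \<in> T" for t x
    unfolding f using cards bip that by (intro bipartite_line_sum_zero) auto
  ultimately have "graph_eigenfunction (gen_paley m) (- real (card T)) f"
    by (simp add: eigen_iff)
  moreover have "2 * card T \<le> card {\<gamma>. g \<gamma> \<noteq> 0}"
    if "graph_eigenfunction (gen_paley m) (- real (card T)) g" for g :: "'a \<Rightarrow> real"
    using that card_support_ge[of g] unfolding eigen_iff by blast
  ultimately show ?thesis
    using cardf unfolding times_divide_eq_right[symmetric] c_real
    by (auto simp flip: of_nat_le_iff[where 'a = real])
qed

end
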